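(* Let $p \neq 2$ be a prime, let $G$ be a finite $p$-group, and let $n$ be a non-negative integer such that $|G'| > p^{n(n-1)/2}$. Then there do not exist two proper subgroups $H_1, H_2$ of $G$ such that every element $x \in G$ with $b(x) \geq n$ lies in $H_1 \cup H_2$.
   Context: $G'$ denotes the derived subgroup of $G$. For $x$ in a finite $p$-group $G$, the breadth $b(x)$ is defined by $|G : C_G(x)| = p^{b(x)}$, where $C_G(x)$ is the centralizer of $x$ in $G$. *)

theory Defs
  imports "HOL-Algebra.Algebra"
begin

definition centralizer :: "('a, 'b) monoid_scheme \<Rightarrow> 'a \<Rightarrow> 'a set" where
  "centralizer G x = {g \<in> carrier G. g \<otimes>\<^bsub>G\<^esub> x = x \<otimes>\<^bsub>G\<^esub> g}"

definition breadth :: "('a, 'b) monoid_scheme \<Rightarrow> nat \<Rightarrow> 'a \<Rightarrow> nat" where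
  "breadth G p x = (THE b. card (carrier G) = p ^ b * card (centralizer G x))"

end

(*
  Suppose all elements outside two proper subgroups have breadth at most b; the claim is
  |G'| <= p^(b(b+1)/2), by induction on |G|.  Enlarge the two subgroups to maximal ones N1, N2 and
  choose a maximal subgroup M meeting N1 and N2 in the same proper subgroup L of M.  As p > 2, some
  x lies outside M, N1 and N2; modulo M' every commutator is of the form [m,x] with m in M, so
  |G'| <= p^b |M'|.  If M' < G', let D be the part of M that is central modulo M'.  An element of
  M - D cannot commute with anything outside M, so its breadth drops by one in M, and the
  induction hypothesis applies to M with L and D.  If M' = G' it applies with L alone.
*)
theory Submission
  imports Defs
begin

text \<open>The obstacle is that passing to M creates a new exceptional subgroup D. With two
  exceptional subgroups already present, the induction closes only if their traces on M coincide;
  this dictates the choice of M. If N1 and N2 differ, the quotient of G by their intersection has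
  order p^2 and is not cyclic; its subgroups of order p meet pairwise trivially, so any third one
  yields an M. The condition p > 2 is needed because x must avoid three proper subgroups at once:
  for p = 2 the three maximal subgroups above the intersection of N1 and N2 cover G. The exponent
  b(b+1)/2 is b + (b-1) + ... + 1: each strict drop from G' to M' costs a factor of at most p^b and
  lowers the bound on the breadth by one. When M' = G' the bound b stays and only the order shrinks,
  so the induction runs over |G| and not over b. The theorem is the case b = n - 1.\<close>

text \<open>Orbit lengths are powers of \<open>p\<close>, and an orbit of length one is a fixed
  point. If \<open>x0\<close> were the only one, the orbit decomposition would give card E \<equiv>
  1 modulo \<open>p\<close>.\<close>

lemma (in group_action) fixed_point_not_unique:
  fixes p k :: nat
  assumes "finite E" "Factorial_Ring.prime p" "order G = p ^ k" "p dvd card E"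
    and "x0 \<in> E" "\<And>g. g \<in> carrier G \<Longrightarrow> \<phi> g x0 = x0"
  obtains x where "x \<in> E" "x \<noteq> x0" "\<And>g. g \<in> carrier G \<Longrightarrow> \<phi> g x = x"
proof (rule ccontr)
  assume "\<not> thesis"
  with that have unique: "\<exists>g\<in>carrier G. \<phi> g x \<noteq> x" if "x \<in> E" "x \<noteq> x0" for x
    using \<open>x \<in> E\<close> \<open>x \<noteq> x0\<close> by blast
  have G: "group G"
    using group_hom group_hom.axioms(1) by blast
  have x0: "orbit G \<phi> x0 = {x0}"
    using assms(6) monoid.one_closed[OF group.is_monoid[OF G]] unfolding orbit_def by force
  have p_dvd: "p dvd card Ob" if Ob: "Ob \<in> orbits G E \<phi> - {{x0}}" for Ob
  proof -
    obtain x where x: "x \<in> E" "Ob = orbit G \<phi> x"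
      using Ob by (auto simp: orbits_def)
    then have "x \<noteq> x0"
      using Ob x0 by auto
    have "card Ob dvd p ^ k"
      using orbit_stabilizer_theorem[OF x(1)] assms(3) x(2) by (metis dvd_triv_left)
    then obtain j where j: "card Ob = p ^ j"
      using divides_primepow_nat[OF assms(2)] by blast
    have "j \<noteq> 0"
    proof
      assume "j = 0"
      then obtain y where "Ob = {y}"
        using j by (auto simp: card_1_singleton_iff)
      then have "Ob = {x}"
        using orbit_refl[OF x(1)] x(2) by auto
      then have "\<phi> g x = x" if "g \<in> carrier G" for g
        using that x(2) by (auto simp: orbit_def)
      then show False
        using unique[OF x(1) \<open>x \<noteq> x0\<close>] by blast
    qed
    then show ?thesis
      by (simp add: j)
  qed
  have fin: "finite (orbits G E \<phi>)"
    using assms(1) by (simp add: orbits_def)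
  have "card E = (\<Sum>Ob\<in>orbits G E \<phi>. card Ob)"
    using disjoint_sum[OF assms(1), of "\<lambda>_. 1::nat"] by simp
  also have "\<dots> = card {x0} + (\<Sum>Ob\<in>orbits G E \<phi> - {{x0}}. card Ob)"
    using fin x0 assms(5) by (intro sum.remove) (auto simp: orbits_def)
  finally have "p dvd 1 + (\<Sum>Ob\<in>orbits G E \<phi> - {{x0}}. card Ob)"
    using assms(4) by simp
  moreover have "p dvd (\<Sum>Ob\<in>orbits G E \<phi> - {{x0}}. card Ob)"
    using p_dvd by (rule dvd_sum)
  ultimately have "p dvd 1"
    by (metis dvd_add_left_iff)
  then show False
    using assms(2) by simp
qed

section \<open>Coset actions and cyclic extensions\<close>

context group
begin

lemma inv_cancel_left:
  assumes "a \<in> carrier G" "b \<in> carrier G"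
  shows "inv a \<otimes> (a \<otimes> b) = b" "a \<otimes> (inv a \<otimes> b) = b"
  using assms by (simp_all flip: m_assoc)

text \<open>Right multiplication reverses products, so the inverse is what makes this a left action.
  The restriction to \<open>rcosets M\<close> is there because members of \<open>Bij\<close> are
  extensional functions.\<close>

lemma rcosets_action:
  assumes "subgroup M G"
  shows "group_action G (rcosets M) (\<lambda>g. \<lambda>Y\<in>rcosets M. Y #> inv g)"
proof -
  have M: "M \<subseteq> carrier G"
    using assms by (rule subgroup.subset)
  have sub: "Y \<subseteq> carrier G" if "Y \<in> rcosets M" for Y
    using that subgroup.rcosets_carrier[OF assms is_group] by blast
  have cl: "Y #> g \<in> rcosets M" if Y: "Y \<in> rcosets M" and g: "g \<in> carrier G" for Y g
  proof -
    obtain a where "a \<in> carrier G" "Y = M #> a"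
      using Y by (auto simp: RCOSETS_def)
    then show ?thesis
      using g coset_mult_assoc[OF M] rcosetsI[OF M] by auto
  qed
  have canc: "Y #> g #> inv g = Y" "Y #> inv g #> g = Y"
    if "Y \<in> rcosets M" "g \<in> carrier G" for Y g
    using that sub coset_mult_assoc coset_mult_one by auto
  have bij: "(\<lambda>Y\<in>rcosets M. Y #> inv g) \<in> Bij (rcosets M)" if g: "g \<in> carrier G" for g
  proof -
    have "bij_betw (\<lambda>Y\<in>rcosets M. Y #> inv g) (rcosets M) (rcosets M)"
      by (rule bij_betw_byWitness[where f' = "\<lambda>y. y #> g"]) (use g cl canc in auto)
    then show ?thesis
      by (simp add: Bij_def)
  qed
  have "(\<lambda>g. \<lambda>Y\<in>rcosets M. Y #> inv g) \<in> hom G (BijGroup (rcosets M))"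
  proof (rule homI)
    fix g h assume gh: "g \<in> carrier G" "h \<in> carrier G"
    show "(\<lambda>Y\<in>rcosets M. Y #> inv (g \<otimes> h)) =
      (\<lambda>Y\<in>rcosets M. Y #> inv g) \<otimes>\<^bsub>BijGroup (rcosets M)\<^esub> (\<lambda>Y\<in>rcosets M. Y #> inv h)"
      using gh bij cl sub
      by (auto simp: BijGroup_def compose_def restrict_def fun_eq_iff inv_mult_group coset_mult_assoc)
  qed (use bij in \<open>simp add: BijGroup_def\<close>)
  then show ?thesis
    unfolding group_action_def group_hom_def group_hom_axioms_def
    using is_group group_BijGroup by blast
qed

text \<open>Since \<open>x [^] p\<close> lies in the normal subgroup \<open>K\<close>, exponents of
  \<open>x\<close> can be reduced modulo \<open>p\<close> at the cost of a factor in
  \<open>K\<close>. So the product of \<open>K\<close> with the cyclic group of \<open>x\<close>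
  consists of at most \<open>p\<close> cosets of \<open>K\<close>.\<close>

lemma cyclic_extension:
  fixes p :: nat
  assumes "K \<lhd> G" "finite K" "x \<in> carrier G" "x [^] p \<in> K" "p > 0"
  obtains E where "subgroup E G" "K \<subseteq> E" "x \<in> E" "card E \<le> p * card K"
proof
  interpret K: normal K G by fact
  interpret second_isomorphism_grp K G "generate G {x}"
    using assms(3) K.normal_axioms
    by (auto intro!: second_isomorphism_grp.intro second_isomorphism_grp_axioms.intro
        generate_is_subgroup)
  let ?E = "K <#> generate G {x}"
  show "subgroup ?E G"
    by (rule normal_set_mult_subgroup)
  show "K \<subseteq> ?E"
    by (rule H_contained_in_set_mult)
  show "x \<in> ?E"
    using S_contained_in_set_mult generate.incl[of x "{x}" G] by blast
  have "?E \<subseteq> (\<lambda>(k, i). k \<otimes> x [^] i) ` (K \<times> {..<p})"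
  proof
    fix e assume "e \<in> ?E"
    then obtain k i where k: "k \<in> K" and e: "e = k \<otimes> x [^] (i::int)"
      by (auto simp: set_mult_def generate_pow[OF assms(3)])
    define q r where "q = i div int p" and "r = nat (i mod int p)"
    have i: "i = int p * q + int r"
      using assms(5) by (simp add: q_def r_def)
    have "x [^] (int p * q) = (x [^] p) [^] q"
      using assms(3) by (metis int_pow_int int_pow_pow)
    then have "x [^] i = (x [^] p) [^] q \<otimes> x [^] r"
      using assms(3) by (simp add: i int_pow_mult int_pow_int)
    moreover have "(x [^] p) [^] q \<in> K"
      using K.subgroup_axioms assms(4) by (rule subgroup_int_pow_closed)
    ultimately have "e = (k \<otimes> (x [^] p) [^] q) \<otimes> x [^] r" "k \<otimes> (x [^] p) [^] q \<in> K"
      using k assms(3) e by (auto simp: m_assoc)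
    moreover have "r < p"
      using assms(5) by (simp add: r_def nat_less_iff)
    ultimately show "e \<in> (\<lambda>(k, i). k \<otimes> x [^] i) ` (K \<times> {..<p})"
      by force
  qed
  then have "card ?E \<le> card ((\<lambda>(k, i). k \<otimes> x [^] i) ` (K \<times> {..<p}))"
    using assms(2) by (intro card_mono) auto
  also have "\<dots> \<le> card (K \<times> {..<p})"
    using assms(2) by (intro card_image_le) auto
  finally show "card ?E \<le> p * card K"
    by (simp add: card_cartesian_product mult.commute)
qed

end

section \<open>Subgroups of index p in finite p-groups\<close>

locale finite_p_group = group G for G (structure) +
  fixes p :: nat
  assumes prime_p: "Factorial_Ring.prime p"
    and finite_carrier: "finite (carrier G)"
    and card_carrier: "\<exists>k. card (carrier G) = p ^ k"
begin

lemma p_gt_1: "p > 1"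
  using prime_p by (rule prime_gt_1_nat)

lemma finite_subgroup: "subgroup M G \<Longrightarrow> finite M"
  using finite_carrier finite_subset subgroup.subset by blast

lemma card_subgroup_power:
  assumes "subgroup M G"
  obtains j where "card M = p ^ j"
proof -
  have "card M dvd card (carrier G)"
    using lagrange[OF assms] by (metis dvd_triv_right order_def)
  then show ?thesis
    using card_carrier divides_primepow_nat[OF prime_p] that by metis
qed

lemma finite_p_group_subgroup:
  assumes "subgroup M G"
  shows "finite_p_group (G\<lparr>carrier := M\<rparr>) p"
proof -
  interpret M: group "G\<lparr>carrier := M\<rparr>"
    using assms subgroup_imp_group by blast
  show ?thesis
    by unfold_locales (use prime_p finite_subgroup[OF assms] card_subgroup_power[OF assms] in auto)
qed

lemma psubset_subgroup_card:
  assumes "subgroup M G" "subgroup H G" "M \<subset> H"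
  shows "p * card M \<le> card H"
proof -
  obtain i j where ij: "card M = p ^ i" "card H = p ^ j"
    using assms card_subgroup_power by metis
  have "card M < card H"
    using assms(3) finite_subgroup[OF assms(2)] by (simp add: psubset_card_mono)
  then have "Suc i \<le> j"
    using ij p_gt_1 by (simp add: Suc_le_eq)
  then have "p ^ Suc i \<le> p ^ j"
    using p_gt_1 by (intro power_increasing) auto
  then show ?thesis
    using ij by simp
qed

lemma proper_subgroup_card:
  assumes "subgroup M G" "M \<noteq> carrier G"
  shows "p * card M \<le> card (carrier G)"
  using psubset_subgroup_card[OF assms(1) subgroup_self] subgroup.subset[OF assms(1)] assms(2)
  by blast

text \<open>Let \<open>M\<close> act on its own right cosets. The coset \<open>M\<close> is fixed,
  and the number of cosets is divisible by \<open>p\<close>, so a second coset \<open>M #> g\<close>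
  is fixed. Being fixed by every \<open>m\<close> means precisely that \<open>g\<close> conjugates
  \<open>M\<close> into itself.\<close>

lemma normalizer_grows:
  assumes M: "subgroup M G" "M \<noteq> carrier G"
  obtains g where "g \<in> carrier G" "g \<notin> M" "\<And>m. m \<in> M \<Longrightarrow> g \<otimes> m \<otimes> inv g \<in> M"
proof -
  have sub: "M \<subseteq> carrier G"
    using M(1) by (rule subgroup.subset)
  interpret act: group_action "G\<lparr>carrier := M\<rparr>" "rcosets M" "\<lambda>g. \<lambda>Y\<in>rcosets M. Y #> inv g"
    using group_action.induced_action[OF rcosets_action[OF M(1)] M(1)] .
  obtain j where j: "order (G\<lparr>carrier := M\<rparr>) = p ^ j"
    using card_subgroup_power[OF M(1)] by (auto simp: order_def)
  obtain k where k: "card (carrier G) = p ^ k"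
    using card_carrier by blast
  have fin: "finite (rcosets M)"
    using finite_carrier by (simp add: RCOSETS_def)
  have "card (rcosets M) \<noteq> 1"
    using lagrange[OF M(1)] M(2) sub finite_carrier
    by (metis card_subset_eq mult_1 order_def)
  moreover have "card (rcosets M) dvd p ^ k"
    using lagrange[OF M(1)] k by (metis dvd_triv_left order_def)
  then obtain i where "card (rcosets M) = p ^ i"
    using divides_primepow_nat[OF prime_p] by blast
  ultimately have p_dvd: "p dvd card (rcosets M)"
    by (cases i) auto
  have M_mem: "M \<in> rcosets M"
    using subgroup.subgroup_in_rcosets[OF M(1) is_group] .
  have fixM: "(\<lambda>Y\<in>rcosets M. Y #> inv g) M = M" if "g \<in> carrier (G\<lparr>carrier := M\<rparr>)" for g
    using that M_mem M(1) sub coset_join2[OF _ M(1), of "inv g"]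
    by (auto simp: subgroup.m_inv_closed)
  obtain Y where Y: "Y \<in> rcosets M" "Y \<noteq> M" "\<And>m. m \<in> M \<Longrightarrow> Y #> inv m = Y"
    using act.fixed_point_not_unique[OF fin prime_p j p_dvd M_mem fixM] by auto
  then obtain g where g: "g \<in> carrier G" "Y = M #> g"
    by (auto simp: RCOSETS_def)
  show ?thesis
  proof
    show "g \<in> carrier G" by fact
    show "g \<notin> M"
      using Y(2) g coset_join2[OF g(1) M(1)] by blast
    fix m assume m: "m \<in> M"
    then have mc: "m \<in> carrier G" "inv m \<in> M"
      using sub M(1) by (auto simp: subgroup.m_inv_closed)
    have "M #> (g \<otimes> m) = M #> g"
      using Y(3)[OF mc(2)] g mc(1) sub by (simp add: coset_mult_assoc)
    then have "M #> (g \<otimes> m \<otimes> inv g) = M"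
      using g mc(1) sub by (metis coset_mult_assoc coset_mult_one inv_closed m_closed r_inv)
    then show "g \<otimes> m \<otimes> inv g \<in> M"
      using coset_join1[OF _ _ M(1)] g mc(1) by auto
  qed
qed

text \<open>Take \<open>M\<close> maximal among the proper subgroups above \<open>K\<close>. Its
  normalizer is strictly larger, hence all of \<open>G\<close>. An element outside \<open>M\<close>
  whose \<open>p\<close>-th power lies in \<open>M\<close> then generates \<open>G\<close> together
  with \<open>M\<close>, which bounds the index by \<open>p\<close>.\<close>

lemma index_p_normal_supergroup:
  assumes K: "subgroup K G" "K \<noteq> carrier G"
  obtains M where "M \<lhd> G" "K \<subseteq> M" "p * card M = card (carrier G)"
proof -
  define \<S> where "\<S> = {M. subgroup M G \<and> M \<noteq> carrier G \<and> K \<subseteq> M}"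
  have "\<S> \<subseteq> Pow (carrier G)"
    by (auto simp: \<S>_def dest: subgroup.subset)
  then have "finite \<S>"
    using finite_carrier by (meson finite_Pow_iff finite_subset)
  moreover have "K \<in> \<S>"
    using K by (simp add: \<S>_def)
  ultimately obtain M where M: "M \<in> \<S>" and max: "\<And>L. L \<in> \<S> \<Longrightarrow> M \<subseteq> L \<Longrightarrow> L = M"
    using finite_has_maximal[of \<S>] by blast
  have sub: "subgroup M G" "M \<noteq> carrier G" "K \<subseteq> M"
    using M by (auto simp: \<S>_def)
  have Mc: "M \<subseteq> carrier G"
    using sub(1) by (rule subgroup.subset)
  have maxD: "L = carrier G" if "subgroup L G" "M \<subseteq> L" "L \<noteq> M" for L
    using that max[of L] sub(3) by (auto simp: \<S>_def)
  \<comment> \<open>\<open>T\<close> is the normalizer of \<open>M\<close>. Equality of the image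
    with \<open>M\<close> gives closure under inverses; by finiteness the inclusion proved in
    \<open>T_mem\<close> is enough for membership.\<close>
  define T where "T = {g \<in> carrier G. (\<lambda>m. g \<otimes> m \<otimes> inv g) ` M = M}"
  have T_mem: "g \<in> T" if g: "g \<in> carrier G" "\<And>m. m \<in> M \<Longrightarrow> g \<otimes> m \<otimes> inv g \<in> M" for g
  proof -
    have "inj_on (\<lambda>m. g \<otimes> m \<otimes> inv g) M"
      using Mc g(1) by (intro inj_onI) (simp add: subset_iff)
    then have "(\<lambda>m. g \<otimes> m \<otimes> inv g) ` M = M"
      using g(2) finite_subgroup[OF sub(1)] by (intro endo_inj_surj) auto
    then show ?thesis
      using g(1) by (simp add: T_def)
  qed
  have "subgroup T G"
  proof (rule subgroupI)
    show "T \<subseteq> carrier G"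
      by (auto simp: T_def)
    show "T \<noteq> {}"
      using T_mem[of \<one>] Mc by (force simp: subset_iff)
  next
    fix g assume g: "g \<in> T"
    then have gc: "g \<in> carrier G"
      by (simp add: T_def)
    show "inv g \<in> T"
    proof (rule T_mem)
      fix m assume "m \<in> M"
      then obtain m' where "m' \<in> M" "m = g \<otimes> m' \<otimes> inv g"
        using g by (auto simp: T_def)
      then show "inv g \<otimes> m \<otimes> inv (inv g) \<in> M"
        using gc Mc by (simp add: m_assoc subset_iff inv_cancel_left)
    qed (use gc in simp)
  next
    fix g h assume gh: "g \<in> T" "h \<in> T"
    then have c: "g \<in> carrier G" "h \<in> carrier G"
      by (auto simp: T_def)
    show "g \<otimes> h \<in> T"
    proof (rule T_mem)
      fix m assume m: "m \<in> M"
      then have "h \<otimes> m \<otimes> inv h \<in> M"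
        using gh(2) by (auto simp: T_def)
      then have "g \<otimes> (h \<otimes> m \<otimes> inv h) \<otimes> inv g \<in> M"
        using gh(1) by (auto simp: T_def)
      then show "g \<otimes> h \<otimes> m \<otimes> inv (g \<otimes> h) \<in> M"
        using c m Mc by (simp add: m_assoc inv_mult_group subset_iff)
    qed (use c in simp)
  qed
  moreover have "M \<subseteq> T"
    using T_mem sub(1) Mc
    by (meson subgroup.m_closed subgroup.m_inv_closed subsetD subsetI)
  moreover obtain g where "g \<in> carrier G" "g \<notin> M" "\<And>m. m \<in> M \<Longrightarrow> g \<otimes> m \<otimes> inv g \<in> M"
    using normalizer_grows[OF sub(1,2)] by blast
  then have "T \<noteq> M"
    using T_mem by blast
  ultimately have T: "T = carrier G"
    using maxD by blast
  have normal: "M \<lhd> G"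
    unfolding normal_inv_iff using sub(1) T by (auto simp: T_def)
  obtain x where x: "x \<in> carrier G" "x \<notin> M"
    using sub(2) Mc by blast
  obtain k where k: "card (carrier G) = p ^ k"
    using card_carrier by blast
  have "x [^] (p ^ k) \<in> M"
    using pow_order_eq_1[OF x(1)] sub(1) k by (simp add: order_def subgroup.one_closed)
  then obtain i where i: "x [^] (p ^ i) \<in> M" "\<And>j. j < i \<Longrightarrow> x [^] (p ^ j) \<notin> M"
    using exists_least_iff[of "\<lambda>i. x [^] (p ^ i) \<in> M"] by blast
  have "i \<noteq> 0"
    using i(1) x by (cases i) auto
  then obtain j where j: "i = Suc j"
    using not0_implies_Suc by blast
  \<comment> \<open>\<open>y\<close> is the last element outside \<open>M\<close> in the sequence of
    iterated \<open>p\<close>-th powers of \<open>x\<close>.\<close>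
  define y where "y = x [^] (p ^ j)"
  have y: "y \<in> carrier G" "y \<notin> M" "y [^] p \<in> M"
    using i x(1) j by (auto simp: y_def nat_pow_pow mult.commute)
  obtain E where E: "subgroup E G" "M \<subseteq> E" "y \<in> E" "card E \<le> p * card M"
    using cyclic_extension[OF normal finite_subgroup[OF sub(1)] y(1,3)] p_gt_1 by auto
  have "E = carrier G"
    using maxD[OF E(1,2)] E(3) y(2) by blast
  then have "p * card M = card (carrier G)"
    using E(4) proper_subgroup_card[OF sub(1,2)] by simp
  then show ?thesis
    using that normal sub(3) by blast
qed

lemma index_p_maximal:
  assumes "subgroup M G" "p * card M = card (carrier G)"
    and "subgroup L G" "M \<subseteq> L" "y \<in> L" "y \<notin> M"
  shows "L = carrier G"
proof -
  have "M \<subset> L"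
    using assms by blast
  from psubset_subgroup_card[OF assms(1,3) this] have "card (carrier G) \<le> card L"
    using assms(2) by simp
  then show ?thesis
    using subgroup.subset[OF assms(3)] finite_carrier card_seteq by blast
qed

lemma index_p_proper:
  assumes "p * card M = card (carrier G)"
  shows "M \<noteq> carrier G"
proof
  assume "M = carrier G"
  moreover have "card (carrier G) > 0"
    using finite_carrier one_closed card_gt_0_iff by blast
  ultimately show False
    using assms p_gt_1 by simp
qed

lemma card_rcosets_index_p:
  assumes "subgroup M G" "p * card M = card (carrier G)"
  shows "card (rcosets M) = p"
proof -
  have "card M > 0"
    using finite_subgroup[OF assms(1)] subgroup.one_closed[OF assms(1)] card_gt_0_iff by blast
  then show ?thesis
    using lagrange[OF assms(1)] assms(2) by (metis mult_right_cancel less_not_refl order_def)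
qed

lemma index_p_pow_mem:
  assumes "M \<lhd> G" "p * card M = card (carrier G)" "x \<in> carrier G"
  shows "x [^] p \<in> M"
proof -
  interpret M: normal M G by fact
  have order: "order (G Mod M) = p"
    using card_rcosets_index_p[OF M.subgroup_axioms assms(2)] by (simp add: order_def FactGroup_def)
  have mem: "M #> x \<in> carrier (G Mod M)"
    using assms(3) by (simp add: carrier_FactGroup)
  have "M #> (x [^] p) = (M #> x) [^]\<^bsub>G Mod M\<^esub> p"
    using M.FactGroup_pow[OF assms(3)] by simp
  also have "\<dots> = M"
    using group.pow_order_eq_1[OF M.factorgroup_is_group mem] by (simp add: order)
  finally show ?thesis
    using coset_join1[OF _ _ M.subgroup_axioms] M.subset assms(3) by auto
qed

text \<open>The index of the trace of \<open>M\<close> on \<open>A\<close> is at most the index of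
  \<open>M\<close>: dividing by a fixed element \<open>a\<close> of \<open>A\<close> in a coset of
  \<open>M\<close> embeds the part of \<open>A\<close> in that coset into
  \<open>M \<inter> A\<close>, and there are \<open>p\<close> cosets.\<close>

lemma card_le_index_p_Int:
  assumes A: "subgroup A G" and M: "subgroup M G" "p * card M = card (carrier G)"
  shows "card A \<le> p * card (M \<inter> A)"
proof -
  have fin: "finite (rcosets M)"
    using finite_carrier by (simp add: RCOSETS_def)
  have Ac: "A \<subseteq> carrier G" and finA: "finite A"
    using A subgroup.subset finite_subgroup by auto
  have le: "card (A \<inter> C) \<le> card (M \<inter> A)" if C: "C \<in> rcosets M" for C
  proof (cases "A \<inter> C = {}")
    case False
    then obtain a where a: "a \<in> A" "a \<in> C"
      by blast
    have "inj_on (\<lambda>c. c \<otimes> inv a) (A \<inter> C)"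
      using a Ac by (intro inj_onI) (simp add: subset_iff)
    moreover have "(\<lambda>c. c \<otimes> inv a) ` (A \<inter> C) \<subseteq> M \<inter> A"
    proof safe
      fix c assume c: "c \<in> A" "c \<in> C"
      then show "c \<otimes> inv a \<in> A"
        using A a by (simp add: subgroup.m_closed subgroup.m_inv_closed)
      obtain g where g: "g \<in> carrier G" "C = M #> g"
        using C by (auto simp: RCOSETS_def)
      have "C = M #> a"
        using repr_independence[of a M g] a g M(1) by simp
      then show "c \<otimes> inv a \<in> M"
        using subgroup.rcos_module_imp[OF M(1) is_group, of a c] c a Ac by blast
    qed
    ultimately show ?thesis
      using finA by (intro card_inj_on_le) auto
  qed simp
  have "A = (\<Union>C\<in>rcosets M. A \<inter> C)"
    using Ac rcosets_part_G[OF M(1)] by blast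
  then have "card A \<le> (\<Sum>C\<in>rcosets M. card (A \<inter> C))"
    using card_UN_le[OF fin, of "\<lambda>C. A \<inter> C"] by simp
  also have "\<dots> \<le> (\<Sum>C\<in>rcosets M. card (M \<inter> A))"
    using le by (rule sum_mono)
  finally show ?thesis
    using card_rcosets_index_p[OF M] by simp
qed

text \<open>For p \<ge> 3 each of the three subgroups has at most a third of the elements, and the
  shared identity makes the union strictly smaller than \<open>G\<close>. For p = 2 this fails: the
  Klein four-group is the union of its three subgroups of order 2.\<close>

lemma not_covered_by_three:
  assumes "p \<noteq> 2"
    and "subgroup K1 G" "K1 \<noteq> carrier G" "subgroup K2 G" "K2 \<noteq> carrier G"
    and "subgroup K3 G" "K3 \<noteq> carrier G"
  obtains x where "x \<in> carrier G" "x \<notin> K1" "x \<notin> K2" "x \<notin> K3"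
proof -
  have "p \<ge> 3"
    using p_gt_1 assms(1) by linarith
  then have le: "3 * card K \<le> card (carrier G)" if "subgroup K G" "K \<noteq> carrier G" for K
    using proper_subgroup_card[OF that] mult_le_mono1[of 3 p "card K"] by linarith
  have "\<one> \<in> K1 \<inter> K2"
    using assms subgroup.one_closed by blast
  then have "card (K1 \<inter> K2) > 0"
    using finite_subgroup[OF assms(2)] card_gt_0_iff by blast
  then have "card (K1 \<union> K2) < card K1 + card K2"
    using card_Un_Int[of K1 K2] finite_subgroup assms by simp
  moreover have "card (K1 \<union> K2 \<union> K3) \<le> card (K1 \<union> K2) + card K3"
    by (rule card_Un_le)
  ultimately have "card (K1 \<union> K2 \<union> K3) < card (carrier G)"
    using le[of K1] le[of K2] le[of K3] assms by linarith
  then have "\<not> carrier G \<subseteq> K1 \<union> K2 \<union> K3"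
    using card_mono[of "K1 \<union> K2 \<union> K3" "carrier G"] finite_subgroup assms by fastforce
  then show ?thesis
    using that by blast
qed

end

section \<open>Commutators in an abelian-by-cyclic group\<close>

text \<open>On the abelian normal subgroup \<open>A\<close> the map a \<mapsto> [a,x] is a
  homomorphism, so its image \<open>B\<close> is already a subgroup. It then suffices that every
  single commutator lies in \<open>B\<close>.\<close>

lemma (in group) derived_abelian_by_cyclic:
  assumes A: "A \<lhd> G" and comm: "\<And>a b. a \<in> A \<Longrightarrow> b \<in> A \<Longrightarrow> a \<otimes> b = b \<otimes> a"
    and x: "x \<in> carrier G"
    and split: "\<And>g. g \<in> carrier G \<Longrightarrow> \<exists>a\<in>A. \<exists>i::nat. g = a \<otimes> x [^] i"
  shows "derived G (carrier G) \<subseteq> (\<lambda>a. a \<otimes> x \<otimes> inv a \<otimes> inv x) ` A"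
proof -
  interpret A: normal A G by fact
  define B where "B = (\<lambda>a. a \<otimes> x \<otimes> inv a \<otimes> inv x) ` A"
  define c where "c = (\<lambda>g a. g \<otimes> a \<otimes> inv g \<otimes> inv a)"
  have conj: "g \<otimes> a \<otimes> inv g \<in> A" if "a \<in> A" "g \<in> carrier G" for a g
    using A.inv_op_closed2[of g a] that by simp
  have BI: "a \<otimes> x \<otimes> inv a \<otimes> inv x \<in> B" if "a \<in> A" for a
    using that by (simp add: B_def)
  have "subgroup B G"
  proof (rule subgroupI)
    show "B \<subseteq> carrier G"
      using x by (auto simp: B_def)
    show "B \<noteq> {}"
      using A.one_closed unfolding B_def by blast
  next
    \<comment> \<open>The conjugate of \<open>inv a\<close> by \<open>x\<close> stays in
      \<open>A\<close>, so it commutes with \<open>b\<close>; this is what makes a \<mapsto> [a,x]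
      multiplicative.\<close>
    have mult: "(a \<otimes> x \<otimes> inv a \<otimes> inv x) \<otimes> (b \<otimes> x \<otimes> inv b \<otimes> inv x) =
        (a \<otimes> b) \<otimes> x \<otimes> inv (a \<otimes> b) \<otimes> inv x" if "a \<in> A" "b \<in> A" for a b
    proof -
      have c: "a \<in> carrier G" "b \<in> carrier G"
        using that by auto
      have "(a \<otimes> x \<otimes> inv a \<otimes> inv x) \<otimes> (b \<otimes> x \<otimes> inv b \<otimes> inv x) =
          a \<otimes> ((x \<otimes> inv a \<otimes> inv x) \<otimes> b) \<otimes> (x \<otimes> inv b \<otimes> inv x)"
        using c x by (simp add: m_assoc)
      also have "(x \<otimes> inv a \<otimes> inv x) \<otimes> b = b \<otimes> (x \<otimes> inv a \<otimes> inv x)"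
        using that x conj[of "inv a" x] by (intro comm) auto
      also have "a \<otimes> (b \<otimes> (x \<otimes> inv a \<otimes> inv x)) \<otimes> (x \<otimes> inv b \<otimes> inv x) =
          a \<otimes> b \<otimes> x \<otimes> (inv a \<otimes> inv b) \<otimes> inv x"
        using c x by (simp add: m_assoc inv_cancel_left)
      also have "inv a \<otimes> inv b = inv (a \<otimes> b)"
        using c comm[OF that] by (simp add: inv_mult_group)
      finally show ?thesis .
    qed
    show "u \<otimes> v \<in> B" if "u \<in> B" "v \<in> B" for u v
      using that mult A.m_closed by (auto simp: B_def)
    show "inv u \<in> B" if u: "u \<in> B" for u
    proof -
      obtain a where a: "a \<in> A" "u = a \<otimes> x \<otimes> inv a \<otimes> inv x"
        using u by (auto simp: B_def)
      have "u \<otimes> (inv a \<otimes> x \<otimes> inv (inv a) \<otimes> inv x) = \<one>"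
        using mult[of a "inv a"] a x by (simp add: A.m_inv_closed)
      then have "inv u = inv a \<otimes> x \<otimes> inv (inv a) \<otimes> inv x"
        using a x by (intro inv_equality) (auto intro: inv_comm)
      then show ?thesis
        using BI[OF A.m_inv_closed[OF a(1)]] by simp
    qed
  qed
  then interpret B: subgroup B G .
  \<comment> \<open>Peeling off one \<open>x\<close> replaces \<open>a\<close> by its conjugate
    \<open>a'\<close> and leaves the factor a' a^-1 = a^-1 a' = [a^-1, x]. As \<open>a\<close>
    changes, the induction must generalize over it.\<close>
  have pow: "c (x [^] i) a \<in> B" if "a \<in> A" for i :: nat and a
    using that
  proof (induction i arbitrary: a)
    case 0
    then show ?case
      using B.one_closed by (simp add: c_def)
  next
    case (Suc i)
    define a' where "a' = x \<otimes> a \<otimes> inv x"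
    have a': "a' \<in> A"
      using conj[OF Suc.prems x] by (simp add: a'_def)
    have cr: "a \<in> carrier G" "x [^] i \<in> carrier G"
      using Suc.prems x by auto
    have xi: "x \<otimes> x [^] i = x [^] i \<otimes> x"
      using x by (metis nat_pow_Suc nat_pow_Suc2)
    have "c (x [^] Suc i) a = (x [^] i \<otimes> a' \<otimes> inv (x [^] i)) \<otimes> inv a"
      using cr x by (simp add: c_def a'_def inv_mult_group m_assoc)
    also have "\<dots> = c (x [^] i) a' \<otimes> (a' \<otimes> inv a)"
      using cr x a' by (simp add: c_def m_assoc inv_cancel_left)
    also have "a' \<otimes> inv a = inv a \<otimes> a'"
      using a' Suc.prems by (intro comm) auto
    also have "\<dots> = inv a \<otimes> x \<otimes> inv (inv a) \<otimes> inv x"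
      using cr x by (simp add: a'_def m_assoc inv_cancel_left)
    also have "c (x [^] i) a' \<otimes> \<dots> \<in> B"
      using Suc.IH[OF a'] BI[OF A.m_inv_closed[OF Suc.prems]] by (rule B.m_closed)
    finally show ?case .
  qed
  have "derived_set G (carrier G) \<subseteq> B"
  proof clarsimp
    fix g h assume "g \<in> carrier G" "h \<in> carrier G"
    then obtain a i b j where ab: "a \<in> A" "b \<in> A"
      and gh: "g = a \<otimes> x [^] (i::nat)" "h = b \<otimes> x [^] (j::nat)"
      using split by metis
    define y z where "y = x [^] i" and "z = x [^] j"
    have cr: "a \<in> carrier G" "b \<in> carrier G" "y \<in> carrier G" "z \<in> carrier G"
      using ab x by (auto simp: y_def z_def)
    have yz: "y \<otimes> z = z \<otimes> y"
      using x by (simp add: y_def z_def nat_pow_mult add.commute)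
    have yz': "y \<otimes> z \<otimes> inv y = z"
      using yz cr by (simp add: m_assoc)
    define b' a' where "b' = y \<otimes> b \<otimes> inv y" and "a' = z \<otimes> inv a \<otimes> inv z"
    have b'a': "b' \<in> A" "a' \<in> A"
      using conj ab cr by (auto simp: b'_def a'_def)
    then have cr': "b' \<in> carrier G" "a' \<in> carrier G"
      by auto
    \<comment> \<open>The aim is [ay, bz] = [z, a^-1] [y, b], valid because \<open>y\<close> and
      \<open>z\<close> commute and \<open>A\<close> is abelian; \<open>pow\<close> covers both
      factors.\<close>
    have "g \<otimes> h \<otimes> inv g \<otimes> inv h = a \<otimes> b' \<otimes> (y \<otimes> z \<otimes> inv y) \<otimes> inv a \<otimes> inv z \<otimes> inv b"
      using cr by (simp add: gh flip: y_def z_def) (simp add: b'_def inv_mult_group m_assoc inv_cancel_left)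
    also have "\<dots> = a \<otimes> b' \<otimes> a' \<otimes> inv b"
      using cr cr' by (simp add: yz' a'_def m_assoc inv_cancel_left)
    also have "\<dots> = (a' \<otimes> a) \<otimes> (b' \<otimes> inv b)"
    proof -
      have "a \<otimes> b' \<otimes> a' = a' \<otimes> (a \<otimes> b')"
        using ab b'a' by (intro comm) auto
      then show ?thesis
        using cr cr' by (simp add: m_assoc inv_cancel_left)
    qed
    also have "\<dots> = c z (inv a) \<otimes> c y b"
      using cr by (simp add: c_def a'_def b'_def m_assoc)
    also have "\<dots> \<in> B"
      using pow ab by (auto simp: y_def z_def)
    finally show "g \<otimes> h \<otimes> inv g \<otimes> inv h \<in> B" .
  qed
  then show ?thesis
    using B.subgroup_axioms generate_subgroup_incl by (simp add: derived_def B_def)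
qed

section \<open>Centralizers and conjugacy classes\<close>

lemma (in group) centralizer_subgroup:
  assumes "x \<in> carrier G"
  shows "subgroup (centralizer G x) G"
proof (rule subgroupI)
  fix a assume a: "a \<in> centralizer G x"
  then have "a \<otimes> x = x \<otimes> a" "a \<in> carrier G"
    by (auto simp: centralizer_def)
  then have "inv a \<otimes> x = x \<otimes> inv a"
    using assms by (metis inv_closed inv_solve_left m_assoc m_closed r_inv r_one)
  then show "inv a \<in> centralizer G x"
    using a by (simp add: centralizer_def)
next
  fix a b assume "a \<in> centralizer G x" "b \<in> centralizer G x"
  then have ab: "a \<in> carrier G" "b \<in> carrier G" "a \<otimes> x = x \<otimes> a" "b \<otimes> x = x \<otimes> b"
    by (auto simp: centralizer_def)
  then have "a \<otimes> b \<otimes> x = x \<otimes> (a \<otimes> b)"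
    using assms by (metis m_assoc)
  then show "a \<otimes> b \<in> centralizer G x"
    using ab by (simp add: centralizer_def)
qed (use assms in \<open>auto simp: centralizer_def\<close>)

lemma (in group) card_conjugacy_class:
  assumes "x \<in> carrier G"
  shows "card ((\<lambda>g. g \<otimes> x \<otimes> inv g) ` carrier G) * card (centralizer G x) = card (carrier G)"
proof -
  let ?\<phi> = "\<lambda>g. \<lambda>h\<in>carrier G. g \<otimes> h \<otimes> inv g"
  have "card (orbit G ?\<phi> x) * card (stabilizer G ?\<phi> x) = order G"
    using group_action.orbit_stabilizer_theorem[OF action_by_conjugation assms] by simp
  moreover have "orbit G ?\<phi> x = (\<lambda>g. g \<otimes> x \<otimes> inv g) ` carrier G"
    using assms by (auto simp: orbit_def)
  moreover have "stabilizer G ?\<phi> x = centralizer G x"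
    using assms by (auto simp: stabilizer_def centralizer_def) (metis inv_solve_right m_closed)+
  ultimately show ?thesis
    by (simp add: order_def)
qed

text \<open>This is the preimage of the centralizer of \<open>h x\<close>. For the projection onto
  G/M' it describes commuting with \<open>x\<close> modulo M' inside \<open>G\<close>
  itself.\<close>

lemma (in group_hom) centralizer_vimage_subgroup:
  assumes "x \<in> carrier G"
  shows "subgroup {g \<in> carrier G. h g \<otimes>\<^bsub>H\<^esub> h x = h x \<otimes>\<^bsub>H\<^esub> h g} G" (is "subgroup ?S G")
proof -
  have C: "subgroup (centralizer H (h x)) H"
    using assms by (intro H.centralizer_subgroup) simp
  have S: "?S = {g \<in> carrier G. h g \<in> centralizer H (h x)}"
    by (auto simp: centralizer_def)
  show ?thesis
    unfolding S
    by (rule G.subgroupI)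
      (use C in \<open>auto simp: subgroup.m_closed subgroup.m_inv_closed subgroup.one_closed intro!: exI[of _ "\<one>"]\<close>)
qed

lemma (in group) card_subgroup_image_Mod:
  assumes "N \<lhd> G" "subgroup D G" "N \<subseteq> D"
  shows "card D = card ((\<lambda>g. N #> g) ` D) * card N"
proof -
  interpret D: group "G\<lparr>carrier := D\<rparr>"
    using assms(2) subgroup_imp_group by blast
  have "subgroup N (G\<lparr>carrier := D\<rparr>)"
    using assms normal_imp_subgroup subgroup_incl by blast
  from D.lagrange[OF this] show ?thesis
    by (simp add: order_def RCOSETS_def UNION_singleton_eq_range)
qed

section \<open>The quotient of G by the derived subgroup of a subgroup M of index p\<close>

context finite_p_group
begin

lemma index_p_split:
  assumes M: "M \<lhd> G" "p * card M = card (carrier G)"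
    and x: "x \<in> carrier G" "x \<notin> M" and g: "g \<in> carrier G"
  shows "\<exists>m\<in>M. \<exists>i::nat. g = m \<otimes> x [^] i"
proof -
  interpret M: normal M G by fact
  interpret second_isomorphism_grp M G "generate G {x}"
    using x M.normal_axioms
    by (auto intro!: second_isomorphism_grp.intro second_isomorphism_grp_axioms.intro
        generate_is_subgroup)
  have "x \<in> M <#> generate G {x}"
    using S_contained_in_set_mult generate.incl[of x "{x}" G] by blast
  then have "M <#> generate G {x} = carrier G"
    using index_p_maximal[OF M.subgroup_axioms M(2) normal_set_mult_subgroup
        H_contained_in_set_mult] x(2) by blast
  then have "g \<in> M <#> generate G {x}"
    using g by simp
  then show ?thesis
    unfolding set_mult_def generate_pow_on_finite_carrier[OF finite_carrier x(1)] by blast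
qed

context
  fixes M
  assumes M: "M \<lhd> G" "p * card M = card (carrier G)"
begin

abbreviation (input) quot_derived where
  "quot_derived \<equiv> \<lambda>g. derived G M #> g"

lemma quot_derived_hom: "group_hom G (G Mod derived G M) quot_derived"
  using normal.r_coset_hom_Mod[OF derived_is_normal[OF M(1)]] is_group
    normal.factorgroup_is_group[OF derived_is_normal[OF M(1)]]
  by (simp add: group_hom_def group_hom_axioms_def)

lemma quot_derived_comm:
  assumes "a \<in> M" "b \<in> M"
  shows "quot_derived a \<otimes>\<^bsub>G Mod derived G M\<^esub> quot_derived b =
    quot_derived b \<otimes>\<^bsub>G Mod derived G M\<^esub> quot_derived a"
proof -
  interpret h: group_hom G "G Mod derived G M" quot_derived
    by (rule quot_derived_hom)
  interpret N: normal "derived G M" G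
    by (rule derived_is_normal[OF M(1)])
  have ab: "a \<in> carrier G" "b \<in> carrier G"
    using assms normal_imp_subgroup[OF M(1)] subgroup.subset by blast+
  have "a \<otimes> b \<otimes> inv a \<otimes> inv b \<in> derived G M"
    using assms by (auto simp: derived_def intro!: generate.incl)
  then have "quot_derived (a \<otimes> b \<otimes> inv a \<otimes> inv b) = derived G M"
    using coset_join2[OF _ N.subgroup_axioms] ab by simp
  moreover have "quot_derived (a \<otimes> b \<otimes> inv a \<otimes> inv b) #> (b \<otimes> a) =
      quot_derived (a \<otimes> b \<otimes> inv a \<otimes> inv b \<otimes> (b \<otimes> a))"
    using ab N.subset by (intro coset_mult_assoc) auto
  moreover have "a \<otimes> b \<otimes> inv a \<otimes> inv b \<otimes> (b \<otimes> a) = a \<otimes> b"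
    using ab by (simp add: m_assoc inv_cancel_left)
  ultimately have "quot_derived (a \<otimes> b) = quot_derived (b \<otimes> a)"
    by metis
  then show ?thesis
    using ab by simp
qed

text \<open>M/M' is an abelian normal subgroup of G/M', and it generates G/M' together with the
  image of \<open>x\<close>, so \<open>derived_abelian_by_cyclic\<close> applies in the
  quotient.\<close>

lemma derived_quot_subset:
  assumes x: "x \<in> carrier G" "x \<notin> M"
  shows "quot_derived ` derived G (carrier G) \<subseteq>
    quot_derived ` (\<lambda>m. m \<otimes> x \<otimes> inv m \<otimes> inv x) ` M"
proof -
  interpret M: normal M G by (rule M(1))
  interpret h: group_hom G "G Mod derived G M" quot_derived
    by (rule quot_derived_hom)
  let ?A = "quot_derived ` M"
  have onto: "quot_derived ` carrier G = carrier (G Mod derived G M)"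
    by (simp add: carrier_FactGroup)
  have A: "?A \<lhd> G Mod derived G M"
    using M.surj_hom_normal_subgroup[OF h.group_hom_axioms onto] .
  have "derived (G Mod derived G M) (carrier (G Mod derived G M)) \<subseteq>
    (\<lambda>a. a \<otimes>\<^bsub>G Mod derived G M\<^esub> quot_derived x \<otimes>\<^bsub>G Mod derived G M\<^esub>
      inv\<^bsub>G Mod derived G M\<^esub> a \<otimes>\<^bsub>G Mod derived G M\<^esub> inv\<^bsub>G Mod derived G M\<^esub> quot_derived x) ` ?A"
  proof (rule h.H.derived_abelian_by_cyclic[OF A])
    show "a \<otimes>\<^bsub>G Mod derived G M\<^esub> b = b \<otimes>\<^bsub>G Mod derived G M\<^esub> a"
      if "a \<in> ?A" "b \<in> ?A" for a b
      using that quot_derived_comm by auto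
    show "quot_derived x \<in> carrier (G Mod derived G M)"
      using x(1) by (rule h.hom_closed)
    fix q assume "q \<in> carrier (G Mod derived G M)"
    then obtain g where g: "g \<in> carrier G" "q = quot_derived g"
      using onto by blast
    then obtain m i where m: "m \<in> M" "g = m \<otimes> x [^] (i::nat)"
      using index_p_split[OF M x] by blast
    then have "q = quot_derived m \<otimes>\<^bsub>G Mod derived G M\<^esub> (quot_derived x [^]\<^bsub>G Mod derived G M\<^esub> i)"
      using g x(1) M.subset by (simp add: h.hom_nat_pow subset_iff del: mult_FactGroup)
    then show "\<exists>a\<in>?A. \<exists>i::nat. q = a \<otimes>\<^bsub>G Mod derived G M\<^esub> quot_derived x [^]\<^bsub>G Mod derived G M\<^esub> i"
      using m(1) by blast
  qed
  moreover have "derived (G Mod derived G M) (carrier (G Mod derived G M)) =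
      quot_derived ` derived G (carrier G)"
    using h.derived_img[of "carrier G"] onto by simp
  moreover have "(\<lambda>a. a \<otimes>\<^bsub>G Mod derived G M\<^esub> quot_derived x \<otimes>\<^bsub>G Mod derived G M\<^esub>
      inv\<^bsub>G Mod derived G M\<^esub> a \<otimes>\<^bsub>G Mod derived G M\<^esub> inv\<^bsub>G Mod derived G M\<^esub> quot_derived x) ` ?A =
      quot_derived ` (\<lambda>m. m \<otimes> x \<otimes> inv m \<otimes> inv x) ` M"
    unfolding image_image
    by (rule image_cong)
      (use x(1) M.subset in \<open>simp_all add: subset_iff del: mult_FactGroup\<close>)
  ultimately show ?thesis
    by simp
qed

text \<open>Each [m,x] is a conjugate of \<open>x\<close> times \<open>inv x\<close>. Hence the
  image of G' in G/M' has at most as many elements as the conjugacy class of \<open>x\<close>, which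
  is at most \<open>p ^ b\<close>.\<close>

lemma card_derived_le:
  assumes x: "x \<in> carrier G" "x \<notin> M"
    and b: "card (carrier G) \<le> p ^ b * card (centralizer G x)"
  shows "card (derived G (carrier G)) \<le> p ^ b * card (derived G M)"
proof -
  have Mc: "M \<subseteq> carrier G"
    using normal_imp_subgroup[OF M(1)] by (rule subgroup.subset)
  let ?cl = "(\<lambda>g. g \<otimes> x \<otimes> inv g) ` carrier G"
  have pos: "card (centralizer G x) > 0"
    using centralizer_subgroup[OF x(1)] finite_subgroup subgroup.one_closed card_gt_0_iff by blast
  have cl: "card ?cl \<le> p ^ b"
    using b card_conjugacy_class[OF x(1)] pos by (metis mult_le_cancel2)
  have "quot_derived ` derived G (carrier G) \<subseteq> (\<lambda>c. quot_derived (c \<otimes> inv x)) ` ?cl"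
    using derived_quot_subset[OF x] Mc by blast
  then have "card (quot_derived ` derived G (carrier G)) \<le> card ((\<lambda>c. quot_derived (c \<otimes> inv x)) ` ?cl)"
    using finite_carrier by (intro card_mono) auto
  also have "\<dots> \<le> card ?cl"
    using finite_carrier by (intro card_image_le) auto
  finally have "card (quot_derived ` derived G (carrier G)) \<le> p ^ b"
    using cl by linarith
  moreover have "card (derived G (carrier G)) =
      card (quot_derived ` derived G (carrier G)) * card (derived G M)"
    using derived_is_normal[OF M(1)] derived_is_subgroup mono_derived[OF Mc]
    by (intro card_subgroup_image_Mod) auto
  ultimately show ?thesis
    by simp
qed

lemma centralizer_le_index_p:
  assumes neq: "derived G M \<noteq> derived G (carrier G)"
  obtains D where "subgroup D G" "D \<subset> M"
    and "\<And>u. u \<in> M - D \<Longrightarrow> centralizer G u \<subseteq> M"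
proof -
  interpret M: normal M G by (rule M(1))
  interpret N: normal "derived G M" G
    by (rule derived_is_normal[OF M(1)])
  interpret h: group_hom G "G Mod derived G M" quot_derived
    by (rule quot_derived_hom)
  define P where "P y = {u \<in> carrier G. quot_derived u \<otimes>\<^bsub>G Mod derived G M\<^esub> quot_derived y =
    quot_derived y \<otimes>\<^bsub>G Mod derived G M\<^esub> quot_derived u}" for y
  have P: "subgroup (P y) G" if "y \<in> carrier G" for y
    unfolding P_def using that by (rule h.centralizer_vimage_subgroup)
  \<comment> \<open>\<open>P y\<close> collects what commutes with \<open>y\<close> modulo M'.
    Intersecting over all \<open>y\<close>, and with \<open>M\<close>, gives the elements of
    \<open>M\<close> that are central modulo M'.\<close>
  define D where "D = \<Inter> (insert M (P ` carrier G))"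
  have "subgroup D G"
    unfolding D_def using P M.subgroup_axioms by (intro subgroups_Inter) auto
  moreover have "D \<noteq> M"
  proof
    assume D: "D = M"
    obtain x where x: "x \<in> carrier G" "x \<notin> M"
      using index_p_proper[OF M(2)] M.subset by blast
    \<comment> \<open>If all of \<open>M\<close> were central modulo M', the commutators [m,x],
      which exhaust G' modulo M', would be trivial there; so G' would lie in M'.\<close>
    have "quot_derived (m \<otimes> x \<otimes> inv m \<otimes> inv x) = derived G M" if m: "m \<in> M" for m
    proof -
      have mc: "m \<in> carrier G"
        using m M.subset by blast
      have "quot_derived (m \<otimes> x) = quot_derived (x \<otimes> m)"
        using m D x(1) M.subset by (auto simp: D_def P_def)
      moreover have "quot_derived (m \<otimes> x) #> (inv m \<otimes> inv x) =
          quot_derived (m \<otimes> x \<otimes> (inv m \<otimes> inv x))"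
        "quot_derived (x \<otimes> m) #> (inv m \<otimes> inv x) =
          quot_derived (x \<otimes> m \<otimes> (inv m \<otimes> inv x))"
        using mc x(1) N.subset by (intro coset_mult_assoc; auto)+
      moreover have "x \<otimes> m \<otimes> (inv m \<otimes> inv x) = \<one>"
        "m \<otimes> x \<otimes> (inv m \<otimes> inv x) = m \<otimes> x \<otimes> inv m \<otimes> inv x"
        using mc x(1) by (simp_all add: m_assoc inv_cancel_left)
      ultimately show ?thesis
        using N.subset by (metis coset_mult_one)
    qed
    then have triv: "quot_derived ` derived G (carrier G) \<subseteq> {derived G M}"
      using derived_quot_subset[OF x] by auto
    have "derived G (carrier G) \<subseteq> derived G M"
    proof
      fix g assume g: "g \<in> derived G (carrier G)"
      then have "g \<in> carrier G"
        using derived_in_carrier by blast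
      moreover have "quot_derived g = derived G M"
        using triv g by blast
      ultimately show "g \<in> derived G M"
        using coset_join1[OF _ _ N.subgroup_axioms] N.subset by blast
    qed
    then show False
      using neq mono_derived[OF M.subset] by blast
  qed
  moreover have "centralizer G u \<subseteq> M" if u: "u \<in> M - D" for u
  proof (rule ccontr)
    assume "\<not> centralizer G u \<subseteq> M"
    then obtain g where g: "g \<in> centralizer G u" "g \<notin> M"
      by blast
    then have gc: "g \<in> carrier G" "g \<otimes> u = u \<otimes> g"
      by (auto simp: centralizer_def)
    have uc: "u \<in> carrier G"
      using u M.subset by blast
    \<comment> \<open>\<open>P u\<close> contains \<open>M\<close> because M/M' is abelian. With the
      additional element \<open>g\<close> outside \<open>M\<close> it is all of \<open>G\<close>,
      and by symmetry \<open>u\<close> then lies in every \<open>P y\<close>, contrary to its choice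
      outside \<open>D\<close>.\<close>
    have "M \<subseteq> P u"
      using quot_derived_comm u M.subset by (auto simp: P_def)
    moreover have "g \<in> P u"
      using gc uc by (simp add: P_def flip: h.hom_mult del: mult_FactGroup)
    ultimately have "P u = carrier G"
      using index_p_maximal[OF M.subgroup_axioms M(2) P[OF uc]] g(2) by blast
    then have "u \<in> D"
      using u uc by (auto simp: D_def P_def)
    then show False
      using u by blast
  qed
  ultimately show ?thesis
    using that[of D] by (auto simp: D_def)
qed

end

end

section \<open>The choice of M\<close>

lemma (in group) derived_cyclic:
  assumes "x \<in> carrier G" "generate G {x} = carrier G"
  shows "derived G (carrier G) = {\<one>}"
proof -
  have power: "\<exists>i::int. g = x [^] i" if "g \<in> carrier G" for g
  proof -
    have "g \<in> generate G {x}"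
      using that assms(2) by simp
    then show ?thesis
      unfolding generate_pow[OF assms(1)] by blast
  qed
  have comm: "g \<otimes> h = h \<otimes> g" if gh: "g \<in> carrier G" "h \<in> carrier G" for g h
  proof -
    obtain i j :: int where "g = x [^] i" "h = x [^] j"
      using power[OF gh(1)] power[OF gh(2)] by blast
    then show ?thesis
      using assms(1) by (metis add.commute int_pow_mult)
  qed
  have "comm_group G"
    using comm by (rule group_comm_groupI)
  then show ?thesis
    using comm_group.derived_eq_singleton[of G "carrier G"] by simp
qed

context finite_p_group
begin

text \<open>If \<open>N1 = N2\<close>, any other subgroup of index \<open>p\<close> will do; one
  exists above the cyclic group of an outside element \<open>x\<close>, which is proper since G' is
  nontrivial. Otherwise \<open>M\<close> contains both the intersection \<open>K\<close> and an
  \<open>x\<close> outside \<open>N1\<close> and \<open>N2\<close>, which forces both traces to be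
  \<open>K\<close>.\<close>

lemma common_trace_index_p:
  assumes N1: "N1 \<lhd> G" "p * card N1 = card (carrier G)"
    and N2: "N2 \<lhd> G" "p * card N2 = card (carrier G)"
    and p2: "p \<noteq> 2" and noncyclic: "card (derived G (carrier G)) \<noteq> 1"
  obtains M where "M \<lhd> G" "p * card M = card (carrier G)"
    and "M \<inter> N1 = M \<inter> N2" "M \<inter> N1 \<noteq> M"
proof -
  have sub: "subgroup N1 G" "subgroup N2 G"
    using N1(1) N2(1) by (auto intro: normal_imp_subgroup)
  obtain x where x: "x \<in> carrier G" "x \<notin> N1" "x \<notin> N2"
    using not_covered_by_three[OF p2 sub(1) _ sub(2) _ sub(1)]
      index_p_proper[OF N1(2)] index_p_proper[OF N2(2)] by blast
  show ?thesis
  proof (cases "N1 = N2")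
    case True
    have "subgroup (generate G {x}) G"
      using x(1) by (simp add: generate_is_subgroup)
    moreover have "generate G {x} \<noteq> carrier G"
      using derived_cyclic[OF x(1)] noncyclic by auto
    ultimately obtain M where M: "M \<lhd> G" "generate G {x} \<subseteq> M" "p * card M = card (carrier G)"
      using index_p_normal_supergroup by blast
    have "x \<in> M"
      using M(2) generate.incl[of x "{x}" G] by blast
    then show ?thesis
      using that M(1,3) True x(2) by blast
  next
    case False
    define K where "K = N1 \<inter> N2"
    have K: "K \<lhd> G"
      unfolding K_def using N1(1) N2(1) by (rule normal_subgroup_intersect)
    have Ksub: "subgroup K G"
      using K by (rule normal_imp_subgroup)
    have pos: "card (carrier G) > 0"
      using finite_carrier one_closed card_gt_0_iff by blast
    have "K \<subset> N1"
    proof -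
      have "\<not> N1 \<subseteq> N2"
        using False N1(2) N2(2) p_gt_1 finite_subgroup[OF sub(2)]
        by (metis card_subset_eq mult_cancel1 not_one_less_zero)
      then show ?thesis
        by (auto simp: K_def)
    qed
    then have "p * card K \<le> card N1"
      using psubset_subgroup_card[OF Ksub sub(1)] by simp
    moreover have "card N1 < card (carrier G)"
      using N1(2) p_gt_1 pos by (cases "card N1 = 0") (auto simp flip: N1(2))
    ultimately have cardK: "p * card K < card (carrier G)"
      by linarith
    have "x [^] p \<in> K"
      using index_p_pow_mem N1 N2 x(1) by (simp add: K_def)
    then obtain E where E: "subgroup E G" "K \<subseteq> E" "x \<in> E" "card E \<le> p * card K"
      using cyclic_extension[OF K finite_subgroup[OF Ksub] x(1)] p_gt_1 by auto
    then have "E \<noteq> carrier G"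
      using cardK by auto
    then obtain M where M: "M \<lhd> G" "E \<subseteq> M" "p * card M = card (carrier G)"
      using index_p_normal_supergroup[OF E(1)] by blast
    have Msub: "subgroup M G"
      using M(1) by (rule normal_imp_subgroup)
    have xM: "x \<in> M" and KM: "K \<subseteq> M"
      using E M by auto
    \<comment> \<open>\<open>x\<close> lies in \<open>M\<close> but not in \<open>L\<close>, so the
      trace of \<open>L\<close> is proper in \<open>M\<close> and has order at most card L / p,
      which is at most card K. Containing \<open>K\<close>, it equals \<open>K\<close>.\<close>
    have trace: "M \<inter> L = K"
      if L: "subgroup L G" "p * card L = card (carrier G)" "K \<subseteq> L" "x \<notin> L"
        "card L \<le> p * card K" for L
    proof -
      have sub_Int: "subgroup (M \<inter> L) G"
        using Msub L(1) by (rule subgroups_Inter_pair)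
      have "p * card (M \<inter> L) \<le> card M"
        using xM L(4) by (intro psubset_subgroup_card[OF sub_Int Msub]) auto
      also have "card M = card L"
        using M(3) L(2) p_gt_1 by (metis mult_cancel1 not_one_less_zero)
      also note L(5)
      finally have "card (M \<inter> L) \<le> card K"
        using p_gt_1 by simp
      then show ?thesis
        using card_seteq[OF finite_subgroup[OF sub_Int], of K] KM L(3) by blast
    qed
    have "M \<inter> N1 = K"
      using card_le_index_p_Int[OF sub(1) sub(2) N2(2)] sub(1) N1(2) x(2)
      by (intro trace) (auto simp: K_def Int_commute)
    moreover have "M \<inter> N2 = K"
      using card_le_index_p_Int[OF sub(2) sub(1) N1(2)] sub(2) N2(2) x(3)
      by (intro trace) (auto simp: K_def)
    ultimately show ?thesis
      using that[OF M(1,3)] xM x(2) by blast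
  qed
qed

end

section \<open>The induction on the group order\<close>

text \<open>The bound on the breadth is stated as an inequality between orders, so that it passes to
  subgroups by cancelling powers of \<open>p\<close>, with no need to evaluate
  \<open>breadth\<close> there.\<close>

lemma card_derived_le_of_small_breadth:
  fixes G :: "('a, 'b) monoid_scheme"
  assumes "finite_p_group G p" "p \<noteq> 2"
    and "subgroup K1 G" "K1 \<noteq> carrier G" "subgroup K2 G" "K2 \<noteq> carrier G"
    and "\<And>x. x \<in> carrier G - (K1 \<union> K2) \<Longrightarrow> card (carrier G) \<le> p ^ b * card (centralizer G x)"
  shows "card (derived G (carrier G)) \<le> p ^ (b * (b + 1) div 2)"
  using assms
proof (induction "card (carrier G)" arbitrary: G b K1 K2 rule: less_induct)
  case less
  interpret finite_p_group G p
    by fact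
  note small = less.prems(7)
  show ?case
  proof (cases "card (derived G (carrier G)) = 1")
    case True
    then show ?thesis
      using p_gt_1 by simp
  next
    case False
    obtain N1 where N1: "N1 \<lhd> G" "K1 \<subseteq> N1" "p * card N1 = card (carrier G)"
      using index_p_normal_supergroup less.prems(3,4) by blast
    obtain N2 where N2: "N2 \<lhd> G" "K2 \<subseteq> N2" "p * card N2 = card (carrier G)"
      using index_p_normal_supergroup less.prems(5,6) by blast
    obtain M where M: "M \<lhd> G" "p * card M = card (carrier G)"
      and trace: "M \<inter> N1 = M \<inter> N2" "M \<inter> N1 \<noteq> M"
      using common_trace_index_p[OF N1(1,3) N2(1,3) less.prems(2) False] by blast
    have sub: "subgroup M G" "subgroup N1 G" "subgroup N2 G"
      using M(1) N1(1) N2(1) by (auto intro: normal_imp_subgroup)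
    have Mc: "M \<subseteq> carrier G"
      using sub(1) by (rule subgroup.subset)
    obtain x where x: "x \<in> carrier G" "x \<notin> M" "x \<notin> N1" "x \<notin> N2"
      using not_covered_by_three[OF less.prems(2) sub(1) index_p_proper[OF M(2)]
          sub(2) index_p_proper[OF N1(3)] sub(3) index_p_proper[OF N2(3)]] by blast
    then have "x \<in> carrier G - (K1 \<union> K2)"
      using N1(2) N2(2) by blast
    from card_derived_le[OF M x(1,2) small[OF this]]
    have le: "card (derived G (carrier G)) \<le> p ^ b * card (derived G M)" .
    define H where "H = G\<lparr>carrier := M\<rparr>"
    define L where "L = M \<inter> N1"
    have H: "finite_p_group H p"
      unfolding H_def using sub(1) by (rule finite_p_group_subgroup)
    have card_H: "card (carrier H) < card (carrier G)"
      using index_p_proper[OF M(2)] Mc finite_carrier by (simp add: H_def psubset_card_mono psubsetI)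
    have subgroup_H: "subgroup D H" if "subgroup D G" "D \<subseteq> M" for D
      unfolding H_def using that sub(1) by (simp add: subgroup_incl)
    have L: "subgroup L H" "L \<noteq> carrier H"
      using trace sub by (auto simp: L_def H_def intro!: subgroup_incl subgroups_Inter_pair)
    have centralizer_H: "centralizer H u = M \<inter> centralizer G u" for u
      using Mc by (auto simp: centralizer_def H_def)
    have derived_H: "derived H (carrier H) = derived G M"
      using derived_consistent[OF _ sub(1)] by (simp add: H_def)
    have small_M: "card (carrier G) \<le> p ^ b * card (centralizer G u)" if "u \<in> M - L" for u
      using that trace(1) N1(2) N2(2) Mc by (intro small) (auto simp: L_def)
    show ?thesis
    proof (cases "derived G M = derived G (carrier G)")
      case True
      \<comment> \<open>Breadth does not grow on passing to \<open>M\<close>: the centralizer loses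
        at most a factor \<open>p\<close>, which is what the group order loses.\<close>
      have "card (carrier H) \<le> p ^ b * card (centralizer H u)" if u: "u \<in> carrier H - (L \<union> L)" for u
      proof -
        have uM: "u \<in> M - L"
          using u by (simp add: H_def)
        then have "subgroup (centralizer G u) G"
          using Mc by (intro centralizer_subgroup) auto
        from card_le_index_p_Int[OF this sub(1) M(2)]
        have "p ^ b * card (centralizer G u) \<le> p ^ b * (p * card (centralizer H u))"
          by (simp add: centralizer_H)
        from order.trans[OF small_M[OF uM] this]
        have "p * card M \<le> p * (p ^ b * card (centralizer H u))"
          using M(2) by (simp only: mult.left_commute)
        then show ?thesis
          using p_gt_1 by (simp add: H_def)
      qed
      from less.hyps[OF card_H H less.prems(2) L L this] show ?thesis
        using derived_H True by simp
    next
      case neq: False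
      obtain D where D: "subgroup D G" "D \<subset> M" and
        cent: "\<And>u. u \<in> M - D \<Longrightarrow> centralizer G u \<subseteq> M"
        using centralizer_le_index_p[OF M neq] by blast
      have "card (derived G M) < card (derived G (carrier G))"
        using neq mono_derived[OF Mc] finite_subgroup[OF derived_is_subgroup]
        by (simp add: psubset_card_mono psubsetI)
      \<comment> \<open>For b = 0 the inequality \<open>le\<close> would exclude the strict drop
        from G' to M'. So the bound can be lowered to the predecessor \<open>c\<close>.\<close>
      then have "b \<noteq> 0"
        using le by (intro notI) simp
      then obtain c where c: "b = Suc c"
        using not0_implies_Suc by blast
      \<comment> \<open>Outside \<open>D\<close> the whole centralizer already lies in
        \<open>M\<close>. The group order loses a factor \<open>p\<close> and the centralizer
        nothing, so the breadth falls by exactly one.\<close>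
      have "card (carrier H) \<le> p ^ c * card (centralizer H u)" if u: "u \<in> carrier H - (L \<union> D)" for u
      proof -
        have uM: "u \<in> M - L" "u \<in> M - D"
          using u by (auto simp: H_def)
        have "centralizer H u = centralizer G u"
          using cent[OF uM(2)] by (auto simp: centralizer_H)
        with small_M[OF uM(1)] have "p * card M \<le> p * (p ^ c * card (centralizer H u))"
          using M(2) by (simp add: c mult.assoc)
        then show ?thesis
          using p_gt_1 by (simp add: H_def)
      qed
      moreover have "subgroup D H" "D \<noteq> carrier H"
        using D subgroup_H by (auto simp: H_def)
      ultimately have "card (derived G M) \<le> p ^ (c * (c + 1) div 2)"
        using less.hyps[OF card_H H less.prems(2) L] derived_H by simp
      then have "card (derived G (carrier G)) \<le> p ^ b * p ^ (c * (c + 1) div 2)"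
        using le mult_le_mono2 order_trans by blast
      also have "b + c * (c + 1) div 2 = b * (b + 1) div 2"
        by (simp add: c algebra_simps)
      then have "p ^ b * p ^ (c * (c + 1) div 2) = p ^ (b * (b + 1) div 2)"
        by (metis power_add)
      finally show ?thesis .
    qed
  qed
qed

section \<open>Breadth and the theorem\<close>

text \<open>This justifies the definite description in \<open>breadth\<close>: an exponent exists
  because the index of the centralizer is a power of \<open>p\<close>, and it is unique because p >
  1.\<close>

lemma (in finite_p_group) card_eq_breadth:
  assumes "x \<in> carrier G"
  shows "card (carrier G) = p ^ breadth G p x * card (centralizer G x)"
proof -
  have C: "subgroup (centralizer G x) G"
    using assms by (rule centralizer_subgroup)
  then have pos: "card (centralizer G x) > 0"
    using finite_subgroup subgroup.one_closed card_gt_0_iff by blast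
  have eq: "card (carrier G) = card (rcosets (centralizer G x)) * card (centralizer G x)"
    using lagrange[OF C] by (simp add: order_def)
  then obtain i where i: "card (rcosets (centralizer G x)) = p ^ i"
    using card_carrier divides_primepow_nat[OF prime_p] by (metis dvd_triv_left)
  have "\<exists>!b. card (carrier G) = p ^ b * card (centralizer G x)"
    using eq i pos p_gt_1 by (intro ex1I[of _ i]) auto
  then show ?thesis
    unfolding breadth_def by (rule theI')
qed

theorem theorem1p2:
  fixes G (structure) and p :: nat and n :: nat
  assumes "group G" and "finite (carrier G)"
    and "Factorial_Ring.prime p" and "p \<noteq> 2"
    and "\<exists>k. card (carrier G) = p ^ k"
    and "p ^ (n * (n - 1) div 2) < card (derived G (carrier G))"
  shows "\<not> (\<exists>H1 H2. subgroup H1 G \<and> H1 \<noteq> carrier G \<and> subgroup H2 G \<and> H2 \<noteq> carrier G \<and>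
            {x \<in> carrier G. n \<le> breadth G p x} \<subseteq> H1 \<union> H2)"
proof
  assume "\<exists>H1 H2. subgroup H1 G \<and> H1 \<noteq> carrier G \<and> subgroup H2 G \<and> H2 \<noteq> carrier G \<and>
            {x \<in> carrier G. n \<le> breadth G p x} \<subseteq> H1 \<union> H2"
  then obtain H1 H2 where H: "subgroup H1 G" "H1 \<noteq> carrier G" "subgroup H2 G" "H2 \<noteq> carrier G"
    and cover: "{x \<in> carrier G. n \<le> breadth G p x} \<subseteq> H1 \<union> H2"
    by blast
  interpret finite_p_group G p
    using assms by (auto simp: finite_p_group_def finite_p_group_axioms_def)
  show False
  proof (cases n)
    case 0
    then have "carrier G \<subseteq> H1 \<union> H2"
      using cover by auto
    then show False
      using not_covered_by_three[OF \<open>p \<noteq> 2\<close> H H(1,2)] by blast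
  next
    case (Suc b)
    have "card (carrier G) \<le> p ^ b * card (centralizer G x)"
      if x: "x \<in> carrier G - (H1 \<union> H2)" for x
    proof -
      \<comment> \<open>Outside both subgroups the breadth is less than n = b + 1, and n(n-1)/2 is
        then the exponent b(b+1)/2 of the bound.\<close>
      have "breadth G p x \<le> b"
        using x cover Suc by fastforce
      then have "p ^ breadth G p x \<le> p ^ b"
        using p_gt_1 by (intro power_increasing) auto
      then have "p ^ breadth G p x * card (centralizer G x) \<le> p ^ b * card (centralizer G x)"
        by (rule mult_le_mono1)
      then show ?thesis
        using card_eq_breadth[of x] x by (metis DiffD1)
    qed
    from card_derived_le_of_small_breadth[OF finite_p_group_axioms \<open>p \<noteq> 2\<close> H this]
    show False
      using assms(6) Suc by (simp add: mult.commute)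
  qed
qed

end
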